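(* Let $f$ be a relation on a compact, metrizable space $X$. The relation $\mathcal Wf$ is a closed, transitive relation and $$\mathcal Wf=\bigcup_{d\in\Gamma_m(X)}\mathcal A_df .$$
   Context: A relation on $X$ is a subset of $X\times X$; $1_X$ is the diagonal; $V^m$ is the $m$-fold composition of $V\subset X\times X$ with itself. $\Gamma_m(X)$ is the set of metrics on $X$ compatible with its topology. For $d\in\Gamma_m(X)$, $\mathcal A_df$ is the set of $(x,y)$ such that for every $\epsilon>0$ there are $n\ge1$ and $(a_1,b_1),\dots,(a_n,b_n)\in f$ with $d(x,a_1)+\sum_{i=1}^{n-1}d(b_i,a_{i+1})+d(b_n,y)<\epsilon$. For a neighborhood $V$ of $1_X$ in $X\times X$ and $x,y\in X$, an $xy,V$ chain of length $n$ (for $f$) is a sequence $(a_1,b_1),\dots,(a_n,b_n)\in f$, $n\geq 1$, such that $(x,a_1)$, $(b_n,y)$ and $(b_i,a_{i+1})$ for $i=1,\dots,n-1$ all lie in $V$. $\mathcal Wf$ is the set of pairs $(x,y)\in X\times X$ such that for every neighborhood $W$ of $1_X$ there exist a closed, symmetric neighborhood $V$ of $1_X$ and $n\in\mathbb N=\{1,2,\dots\}$ such that there is an $xy,V$ chain of length $n$ and $V^{3^n}\subset W$. *)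

theory Defs
  imports "HOL-Analysis.Analysis"
begin

definition diag_nbhd :: "'a topology \<Rightarrow> ('a \<times> 'a) set \<Rightarrow> bool" where
  "diag_nbhd X V \<longleftrightarrow> V \<subseteq> topspace X \<times> topspace X \<and>
     (\<exists>U. openin (prod_topology X X) U \<and> Id_on (topspace X) \<subseteq> U \<and> U \<subseteq> V)"

(* A metric is a total function of type 'a => 'a => real, as in the locale Metric_space; only its
   values on topspace X are relevant in what follows. *)
definition compatible_metrics :: "'a topology \<Rightarrow> ('a \<Rightarrow> 'a \<Rightarrow> real) set" where
  "compatible_metrics X =
     {d. Metric_space (topspace X) d \<and> Metric_space.mtopology (topspace X) d = X}"

definition metric_chain_rel ::
    "'a topology \<Rightarrow> ('a \<Rightarrow> 'a \<Rightarrow> real) \<Rightarrow> ('a \<times> 'a) set \<Rightarrow> ('a \<times> 'a) set" where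
  "metric_chain_rel X d f = {(x, y). x \<in> topspace X \<and> y \<in> topspace X \<and>
     (\<forall>\<epsilon>>0. \<exists>n a b. 1 \<le> n \<and> (\<forall>i\<in>{1..n::nat}. (a i, b i) \<in> f) \<and>
        d x (a 1) + (\<Sum>i=1..<n. d (b i) (a (i + 1))) + d (b n) y < \<epsilon>)}"

definition nbhd_chain ::
    "('a \<times> 'a) set \<Rightarrow> ('a \<times> 'a) set \<Rightarrow> 'a \<Rightarrow> 'a \<Rightarrow> nat \<Rightarrow> (nat \<Rightarrow> 'a) \<Rightarrow> (nat \<Rightarrow> 'a) \<Rightarrow> bool" where
  "nbhd_chain f V x y n a b \<longleftrightarrow> 1 \<le> n \<and> (\<forall>i\<in>{1..n}. (a i, b i) \<in> f) \<and>
     (x, a 1) \<in> V \<and> (b n, y) \<in> V \<and> (\<forall>i\<in>{1..<n}. (b i, a (i + 1)) \<in> V)"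

(* The power V ^^ m is composition on the whole type and V ^^ 0 = Id, but here m = 3 ^ n \<ge> 1, so
   this is the power of V as a relation on topspace X. *)
definition W_rel :: "'a topology \<Rightarrow> ('a \<times> 'a) set \<Rightarrow> ('a \<times> 'a) set" where
  "W_rel X f = {(x, y). x \<in> topspace X \<and> y \<in> topspace X \<and>
     (\<forall>W. diag_nbhd X W \<longrightarrow>
        (\<exists>V n. diag_nbhd X V \<and> closedin (prod_topology X X) V \<and> sym V \<and> 1 \<le> n \<and>
           (\<exists>a b. nbhd_chain f V x y n a b) \<and> V ^^ (3 ^ n) \<subseteq> W))}"

end

theory Submission
  imports Defs
begin

text \<open>If \<open>d\<close> is compatible and a chain has total gap length below \<open>\<epsilon>\<close>, add its finitely many gaps
  to \<open>{d \<le> \<delta>}\<close>: a shortest walk in the resulting relation uses each gap at most once, so walks of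
  length \<open>3 ^ n\<close> move by at most about \<open>\<epsilon> + 3 ^ n \<delta>\<close>, which gives \<open>\<A>\<^sub>d f \<subseteq> \<W> f\<close>.
  Conversely, choose \<open>V\<^sub>k\<close> and \<open>n\<^sub>k\<close> recursively from the definition of \<open>\<W> f\<close>, with the \<open>3 ^ n\<^sub>k\<close>-th
  power of \<open>V\<^sub>k\<close> inside the previous neighborhood; the intermediate powers form a sequence of
  entourages \<open>U\<close> with \<open>U (i + 1) ^ 3 \<subseteq> U i\<close>, and the metric of the metrization lemma satisfies
  \<open>d \<le> 2 ^ -(n\<^sub>1 + \<dots> + n\<^sub>k)\<close> on \<open>V\<^sub>k\<close>, so the chain of length \<open>n\<^sub>k\<close> in \<open>V\<^sub>k\<close> is short.
  Transitivity and closedness follow by adding to a neighborhood the gaps of a first chain, or the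
  two end gaps of a chain for a nearby pair, and using the same shortest walk estimate.\<close>

section \<open>Powers of relations\<close>

lemma relpow_refl_mono:
  assumes "Id_on A \<subseteq> R" "(x, y) \<in> R ^^ m" "m \<le> n" "x \<in> A"
  shows "(x, y) \<in> R ^^ n"
proof -
  have "(x, x) \<in> R ^^ k" for k
  proof (induction k)
    case (Suc k)
    then show ?case using assms(1,4) by (auto intro: relpow_Suc_I)
  qed simp
  then have "(x, y) \<in> R ^^ ((n - m) + m)" using assms(2) relpow_trans by metis
  then show ?thesis using assms(3) by simp
qed

lemma relpow_subset_Times:
  assumes "R \<subseteq> A \<times> A" "0 < n"
  shows "R ^^ n \<subseteq> A \<times> A"
proof -
  obtain m where "n = Suc m" using assms(2) gr0_implies_Suc by blast
  moreover have "R ^^ Suc m \<subseteq> A \<times> A" using assms(1)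
    by (induction m) auto
  ultimately show ?thesis by simp
qed

lemma relpow_power_mult: "R ^^ (m * n) = (R ^^ m) ^^ n" for R :: "('a \<times> 'a) set"
  by (induction n) (simp_all add: relpow_add relpow_commute)

lemma sym_relpow: "sym R \<Longrightarrow> sym (R ^^ n)"
proof (induction n)
  case 0
  show ?case by (auto simp: sym_def)
next
  case (Suc n)
  then show ?case unfolding sym_def by (metis relpow_Suc_E relpow_Suc_I2)
qed

section \<open>Compatible metrics and neighborhoods of the diagonal\<close>

lemma compatible_metrics_iff:
  "d \<in> compatible_metrics X \<longleftrightarrow>
     Metric_space (topspace X) d \<and> Metric_space.mtopology (topspace X) d = X"
  by (simp add: compatible_metrics_def)

lemma compatible_metrics_nonempty:
  assumes "metrizable_space X"
  obtains d where "d \<in> compatible_metrics X"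
  using assms unfolding metrizable_space_def compatible_metrics_iff
  by (metis Metric_space.topspace_mtopology)

lemma continuous_map_compatible_metric:
  assumes "d \<in> compatible_metrics X"
  shows "continuous_map (prod_topology X X) euclideanreal (\<lambda>p. d (fst p) (snd p))"
proof -
  interpret Metric_space "topspace X" d using assms by (simp add: compatible_metrics_iff)
  let ?m = "metric (topspace X, d)"
  have X: "mtopology_of ?m = X"
    using assms by (simp add: compatible_metrics_iff)
  have "continuous_map (prod_topology X X) euclideanreal (\<lambda>p. mdist ?m (fst p) (snd p))"
    by (rule continuous_map_mdist) (simp_all only: X continuous_map_fst continuous_map_snd)
  then show ?thesis by simp
qed

lemma closedin_metric_le:
  assumes "d \<in> compatible_metrics X"
  shows "closedin (prod_topology X X) {(u, v) \<in> topspace X \<times> topspace X. d u v \<le> e}"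
  using closedin_continuous_map_preimage[OF continuous_map_compatible_metric[OF assms], of "{..e}"]
  by (simp add: case_prod_unfold mem_Times_iff conj_assoc)

lemma diag_nbhd_metric_le:
  assumes "d \<in> compatible_metrics X" "0 < e"
  shows "diag_nbhd X {(u, v) \<in> topspace X \<times> topspace X. d u v \<le> e}"
proof -
  interpret Metric_space "topspace X" d using assms by (simp add: compatible_metrics_iff)
  have "openin (prod_topology X X) {(u, v) \<in> topspace X \<times> topspace X. d u v < e}"
    using openin_continuous_map_preimage[OF continuous_map_compatible_metric[OF assms(1)], of "{..<e}"]
    by (simp add: case_prod_unfold mem_Times_iff conj_assoc)
  then show ?thesis
    unfolding diag_nbhd_def using assms(2) by (intro conjI exI) auto
qed

text \<open>The complement of an open set containing the diagonal is compact and \<open>d\<close> is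
  continuous without zeros on it, so \<open>d\<close> is bounded away from 0 there.\<close>

lemma diag_nbhd_metric_ball:
  assumes "compact_space X" "d \<in> compatible_metrics X" "diag_nbhd X W"
  obtains e where "0 < e" "\<And>u v. \<lbrakk>u \<in> topspace X; v \<in> topspace X; d u v < e\<rbrakk> \<Longrightarrow> (u, v) \<in> W"
proof -
  interpret Metric_space "topspace X" d using assms by (simp add: compatible_metrics_iff)
  obtain U where U: "openin (prod_topology X X) U" "Id_on (topspace X) \<subseteq> U" "U \<subseteq> W"
    using assms(3) unfolding diag_nbhd_def by blast
  define K where "K = topspace (prod_topology X X) - U"
  have "closedin (prod_topology X X) K" unfolding K_def using U(1) by blast
  then have "compactin (prod_topology X X) K"
    using assms(1) by (simp add: closedin_compact_space compact_space_prod_topology)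
  then have c: "compact ((\<lambda>p. d (fst p) (snd p)) ` K)"
    using image_compactin[OF _ continuous_map_compatible_metric[OF assms(2)]] by auto
  have "0 \<notin> (\<lambda>p. d (fst p) (snd p)) ` K"
    using U(2) by (auto simp: K_def)
  then obtain e where e: "e > 0" "\<And>r. r \<in> (\<lambda>p. d (fst p) (snd p)) ` K \<Longrightarrow> e \<le> dist 0 r"
    using separate_point_closed[OF compact_imp_closed[OF c]] by blast
  show ?thesis
  proof
    fix u v assume *: "u \<in> topspace X" "v \<in> topspace X" "d u v < e"
    then have "(u, v) \<notin> K" using e(2)[of "d u v"] by force
    then show "(u, v) \<in> W" using * U(3) by (auto simp: K_def)
  qed (fact e(1))
qed

lemma diag_nbhd_refl: "diag_nbhd X V \<Longrightarrow> Id_on (topspace X) \<subseteq> V"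
  and diag_nbhd_subset: "diag_nbhd X V \<Longrightarrow> V \<subseteq> topspace X \<times> topspace X"
  unfolding diag_nbhd_def by blast+

lemma diag_nbhd_mono:
  "\<lbrakk>diag_nbhd X V; V \<subseteq> W; W \<subseteq> topspace X \<times> topspace X\<rbrakk> \<Longrightarrow> diag_nbhd X W"
  unfolding diag_nbhd_def by blast

lemma diag_nbhd_Int:
  "\<lbrakk>diag_nbhd X V; diag_nbhd X W\<rbrakk> \<Longrightarrow> diag_nbhd X (V \<inter> W)"
  unfolding diag_nbhd_def by (meson Int_mono le_infI openin_Int inf.coboundedI1)

lemma diag_nbhd_subset_relpow:
  assumes "diag_nbhd X V" "0 < n"
  shows "V \<subseteq> V ^^ n"
proof clarify
  fix x y assume "(x, y) \<in> V"
  then show "(x, y) \<in> V ^^ n"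
    using relpow_refl_mono[OF diag_nbhd_refl[OF assms(1)], of x y 1 n]
      diag_nbhd_subset[OF assms(1)] assms(2) by auto
qed

lemma diag_nbhd_relpow:
  assumes "diag_nbhd X V" "0 < n"
  shows "diag_nbhd X (V ^^ n)"
  using diag_nbhd_mono[OF assms(1) diag_nbhd_subset_relpow[OF assms]]
    relpow_subset_Times[OF diag_nbhd_subset[OF assms(1)] assms(2)] by blast

section \<open>Walks with finitely many additional edges\<close>

text \<open>Consecutive steps in \<open>R\<close> are collected in blocks of length \<open>M\<close>, each of which costs at most
  \<open>\<delta>\<close>; every other step closes an incomplete block, which costs at most another \<open>\<delta>\<close>.\<close>

lemma walk_metric_bound:
  fixes \<delta> :: real and C M :: nat
  assumes "Metric_space A d" and R: "Id_on A \<subseteq> R" "R \<subseteq> A \<times> A"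
    and M: "0 < M" "\<And>u v. (u, v) \<in> R ^^ M \<Longrightarrow> d u v \<le> \<delta>"
    and z: "\<And>i. i \<le> k \<Longrightarrow> z i \<in> A"
    and k: "k \<le> C * M"
  shows "d (z 0) (z k) \<le>
    (\<Sum>i | i < k \<and> (z i, z (Suc i)) \<notin> R. d (z i) (z (Suc i)) + \<delta>) + (real C + 1) * \<delta>"
proof -
  interpret Metric_space A d by fact
  define w where "w i = (if (z i, z (Suc i)) \<in> R then 0 else d (z i) (z (Suc i)) + \<delta>)" for i
  have short: "d u v \<le> \<delta>" if "(u, v) \<in> R ^^ r" "r \<le> M" "u \<in> A" for u v r
    using M(2) relpow_refl_mono[OF R(1) that] by blast
  \<comment> \<open>Invariant: \<open>c\<close> blocks are complete, and \<open>u\<close> starts the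
    current block, of which \<open>r\<close> steps have been made and not yet charged. The
    inequality \<open>c * M + r \<le> j\<close> later yields \<open>c \<le> C\<close>.\<close>
  have "\<exists>u r c. u \<in> A \<and> r < M \<and> (u, z j) \<in> R ^^ r \<and> c * M + r \<le> j \<and>
      d (z 0) u \<le> sum w {..<j} + c * \<delta>" if "j \<le> k" for j
    using that
  proof (induction j)
    case 0
    then show ?case using M(1) z[of 0] by (intro exI[of _ "z 0"] exI[of _ 0]) simp
  next
    case (Suc j)
    then obtain u r c where u: "u \<in> A" "r < M" "(u, z j) \<in> R ^^ r" "c * M + r \<le> j"
      "d (z 0) u \<le> sum w {..<j} + c * \<delta>" by auto
    have A: "z 0 \<in> A" "z j \<in> A" "z (Suc j) \<in> A" using z Suc.prems by auto
    show ?case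
    proof (cases "(z j, z (Suc j)) \<in> R")
      case True
      then have step: "(u, z (Suc j)) \<in> R ^^ Suc r" using u(3) by auto
      have w: "sum w {..<Suc j} = sum w {..<j}" using True by (simp add: w_def)
      show ?thesis
      proof (cases "Suc r < M")
        case True
        then show ?thesis using u step w by (intro exI[of _ u] exI[of _ "Suc r"] exI[of _ c]) auto
      next
        case False
        then have r: "Suc r = M" using u(2) by simp
        have "d (z 0) (z (Suc j)) \<le> sum w {..<Suc j} + Suc c * \<delta>"
          using triangle[OF A(1) u(1) A(3)] short[OF step _ u(1)] u(2,5) w
          by (simp add: algebra_simps)
        moreover have "Suc c * M \<le> Suc j" using u(4) r by simp
        ultimately show ?thesis using A(3) M(1)
          by (intro exI[of _ "z (Suc j)"] exI[of _ 0] exI[of _ "Suc c"]) auto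
      qed
    next
      case False
      then have w: "sum w {..<Suc j} = sum w {..<j} + d (z j) (z (Suc j)) + \<delta>"
        by (simp add: w_def)
      have "d (z 0) (z (Suc j)) \<le> d (z 0) u + d u (z j) + d (z j) (z (Suc j))"
        using triangle[OF A(1) A(2) A(3)] triangle[OF A(1) u(1) A(2)] by simp
      also have "\<dots> \<le> sum w {..<Suc j} + c * \<delta>"
        using short[OF u(3) _ u(1)] u(2,5) w by simp
      finally show ?thesis using A(3) M(1) u(4)
        by (intro exI[of _ "z (Suc j)"] exI[of _ 0] exI[of _ c]) auto
    qed
  qed
  from this[of k] obtain u r c where u: "u \<in> A" "r < M" "(u, z k) \<in> R ^^ r" "c * M + r \<le> k"
      "d (z 0) u \<le> sum w {..<k} + c * \<delta>" by auto
  have A: "z 0 \<in> A" "z k \<in> A" using z by auto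
  have "c * M \<le> C * M" using add_leD1[OF u(4)] k by (rule order_trans)
  then have c: "c \<le> C" using M(1) by simp
  have "0 \<le> \<delta>" using short[OF u(3) _ u(1)] u(2) nonneg[of u "z k"] by linarith
  then have "real c * \<delta> \<le> C * \<delta>" using c by (intro mult_right_mono) auto
  moreover have "d (z 0) (z k) \<le> sum w {..<k} + c * \<delta> + \<delta>"
    using triangle[OF A(1) u(1) A(2)] short[OF u(3) _ u(1)] u(2,5) by simp
  moreover have "sum w {..<k} = (\<Sum>i | i < k \<and> (z i, z (Suc i)) \<notin> R. d (z i) (z (Suc i)) + \<delta>)"
    unfolding w_def by (subst sum.mono_neutral_cong_right[of "{..<k}"
        "{i. i < k \<and> (z i, z (Suc i)) \<notin> R}" _ "\<lambda>i. d (z i) (z (Suc i)) + \<delta>"]) auto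
  ultimately show ?thesis by (simp add: algebra_simps)
qed

text \<open>A shortest walk visits no point twice, so it uses each of the additional edges \<open>E\<close> at most
  once.\<close>

lemma relpow_extended_metric_bound:
  fixes \<delta> :: real and C M :: nat
  assumes "Metric_space A d" and R: "Id_on A \<subseteq> R" "R \<subseteq> A \<times> A"
    and M: "0 < M" "\<And>u v. (u, v) \<in> R ^^ M \<Longrightarrow> d u v \<le> \<delta>"
    and E: "finite E" "E \<subseteq> A \<times> A"
    and p: "p \<in> A" "(p, q) \<in> (R \<union> E \<union> E\<inverse>) ^^ L" "L \<le> C * M"
  shows "d p q \<le> (\<Sum>(u, v)\<in>E. d u v) + (real (card E) + real C + 1) * \<delta>"
proof -
  interpret Metric_space A d by fact
  define V where "V = R \<union> E \<union> E\<inverse>"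
  have VA: "V \<subseteq> A \<times> A" using R(2) E(2) by (auto simp: V_def)
  have "0 \<le> d p p" by simp
  moreover have "(p, p) \<in> R ^^ M" using relpow_refl_mono[OF R(1), of p p 0] p(1) by simp
  ultimately have \<delta>: "0 \<le> \<delta>" using M(2) order_trans by blast
  define k where "k = (LEAST k. (p, q) \<in> V ^^ k)"
  have k: "(p, q) \<in> V ^^ k" unfolding k_def using p(2) by (intro LeastI) (simp add: V_def)
  have kL: "k \<le> L" unfolding k_def using p(2) by (intro Least_le) (simp add: V_def)
  have least: "k \<le> j" if "(p, q) \<in> V ^^ j" for j unfolding k_def using that by (rule Least_le)
  obtain z where z: "z 0 = p" "z k = q" "\<And>i. i < k \<Longrightarrow> (z i, z (Suc i)) \<in> V"
    using k unfolding relpow_fun_conv by blast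
  have zA: "z i \<in> A" if "i \<le> k" for i
  proof (cases i)
    case (Suc j)
    then show ?thesis using z(3)[of j] that VA by auto
  qed (use z(1) p(1) in simp)
  have seg: "(z i, z (i + j)) \<in> V ^^ j" if "i + j \<le> k" for i j
    using that by (induction j) (auto intro!: relcompI z(3))
  \<comment> \<open>Cutting out the closed piece between two visits of a point would leave a walk of
    length \<open>i + (k - j)\<close>, shorter than \<open>k\<close>.\<close>
  have inj: "z i \<noteq> z j" if "i < j" "j \<le> k" for i j
  proof
    assume "z i = z j"
    then have "(z 0, z i) \<in> V ^^ i" "(z i, z k) \<in> V ^^ (k - j)"
      using seg[of 0 i] seg[of j "k - j"] that by simp_all
    then have "(p, q) \<in> V ^^ (i + (k - j))" using z(1,2) relpow_trans by fastforce
    then show False using least that by fastforce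
  qed
  define I where "I = {i. i < k \<and> (z i, z (Suc i)) \<notin> R}"
  have "\<exists>e\<in>E. e = (z i, z (Suc i)) \<or> e = (z (Suc i), z i)" if "i \<in> I" for i
    using that z(3)[of i] by (auto simp: I_def V_def)
  then obtain e where e: "\<And>i. i \<in> I \<Longrightarrow> e i \<in> E"
    "\<And>i. i \<in> I \<Longrightarrow> e i = (z i, z (Suc i)) \<or> e i = (z (Suc i), z i)"
    by metis
  have inj_e: "inj_on e I"
  proof (rule linorder_inj_onI)
    fix i j assume ij: "i < j" "i \<in> I" "j \<in> I"
    \<comment> \<open>If two steps used the same edge, traversing it in the same direction would
      force \<open>z i = z j\<close>, and traversing it in opposite directions
      \<open>z i = z (Suc j)\<close>.\<close>
    then have "z i \<noteq> z j" "z i \<noteq> z (Suc j)" using inj by (auto simp: I_def)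
    then show "e i \<noteq> e j" using e(2)[OF ij(2)] e(2)[OF ij(3)] by auto
  qed auto
  have "d p q \<le> (\<Sum>i\<in>I. d (z i) (z (Suc i)) + \<delta>) + (real C + 1) * \<delta>"
    using walk_metric_bound[OF assms(1) R M, of k z C] zA kL p(3) z(1,2)
    by (simp add: I_def)
  also have "(\<Sum>i\<in>I. d (z i) (z (Suc i)) + \<delta>) = (\<Sum>i\<in>I. case e i of (u, v) \<Rightarrow> d u v + \<delta>)"
    using e(2) commute by (intro sum.cong) fastforce+
  also have "\<dots> = (\<Sum>(u, v)\<in>e ` I. d u v + \<delta>)"
    by (simp add: sum.reindex[OF inj_e])
  also have "\<dots> \<le> (\<Sum>(u, v)\<in>E. d u v + \<delta>)"
    using E(1) e(1) \<delta> nonneg by (intro sum_mono2) (auto simp: add_nonneg_nonneg)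
  also have "\<dots> = (\<Sum>(u, v)\<in>E. d u v) + card E * \<delta>"
    by (simp add: case_prod_unfold sum.distrib)
  finally show ?thesis by (simp add: algebra_simps)
qed

text \<open>The gaps of a chain will be collected into a set, where repetitions count once; as
  distances are nonnegative, this can only lower the sum.\<close>

lemma sum_image_metric_le:
  assumes "Metric_space A d" "finite J"
  shows "(\<Sum>(u, v)\<in>g ` J. d u v) \<le> (\<Sum>j\<in>J. d (fst (g j)) (snd (g j)))"
proof -
  interpret Metric_space A d by fact
  show ?thesis using sum_image_le[OF assms(2), of "\<lambda>(u, v). d u v" g]
    by (simp add: case_prod_unfold)
qed

text \<open>Finite sets are closed in the Hausdorff product, so adding finitely many edges and their
  inverses keeps a neighborhood admissible in the definition of \<open>W_rel\<close>.\<close>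

lemma extended_diag_nbhd:
  assumes "metrizable_space X" and R: "diag_nbhd X R" "closedin (prod_topology X X) R" "sym R"
    and E: "finite E" "E \<subseteq> topspace X \<times> topspace X"
  shows "diag_nbhd X (R \<union> E \<union> E\<inverse>)" "closedin (prod_topology X X) (R \<union> E \<union> E\<inverse>)"
    "sym (R \<union> E \<union> E\<inverse>)"
proof -
  show "diag_nbhd X (R \<union> E \<union> E\<inverse>)"
    by (rule diag_nbhd_mono[OF R(1)]) (use E(2) diag_nbhd_subset[OF R(1)] in auto)
  have H: "Hausdorff_space (prod_topology X X)"
    using assms(1) by (simp add: metrizable_imp_Hausdorff_space Hausdorff_space_prod_topology)
  have "closedin (prod_topology X X) (E \<union> E\<inverse>)"
    by (rule closedin_Hausdorff_finite[OF H]) (use E in auto)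
  then show "closedin (prod_topology X X) (R \<union> E \<union> E\<inverse>)"
    using R(2) by (simp add: Un_assoc closedin_Un)
  show "sym (R \<union> E \<union> E\<inverse>)" using R(3) by (auto simp: sym_def)
qed

section \<open>Metrization by a sequence of entourages\<close>

primrec entourage_walk :: "(nat \<Rightarrow> ('a \<times> 'a) set) \<Rightarrow> 'a \<Rightarrow> (nat \<times> 'a) list \<Rightarrow> 'a \<Rightarrow> bool" where
  "entourage_walk U u [] v \<longleftrightarrow> u = v"
| "entourage_walk U u (p # ps) v \<longleftrightarrow> (u, snd p) \<in> U (fst p) \<and> entourage_walk U (snd p) ps v"

text \<open>An entry of the list holds the index of the entourage used by a step and the point
  reached. The index is recorded because a pair may lie in several entourages, at different
  costs.\<close>

definition walk_cost :: "(nat \<times> 'a) list \<Rightarrow> real" where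
  "walk_cost ps = (\<Sum>p\<leftarrow>ps. (1 / 2) ^ fst p)"

lemma walk_cost_simps [simp]:
  "walk_cost [] = 0" "walk_cost (p # ps) = (1 / 2) ^ fst p + walk_cost ps"
  "walk_cost (ps @ qs) = walk_cost ps + walk_cost qs"
  by (simp_all add: walk_cost_def)

lemma walk_cost_nonneg: "0 \<le> walk_cost ps"
  by (induction ps) auto

lemma entourage_walk_append:
  "entourage_walk U u (ps @ qs) v \<longleftrightarrow> (\<exists>w. entourage_walk U u ps w \<and> entourage_walk U w qs v)"
  by (induction ps arbitrary: u) auto

text \<open>The walk is reversed: the indices appear in opposite order, and each entry now holds the
  point from which the old step started.\<close>

lemma entourage_walk_sym:
  assumes "\<And>i. sym (U i)" "entourage_walk U u ps v"
  shows "\<exists>qs. entourage_walk U v qs u \<and> walk_cost qs = walk_cost ps"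
  using assms(2)
proof (induction ps arbitrary: u)
  case Nil
  then show ?case by (intro exI[of _ "[]"]) simp
next
  case (Cons p ps)
  then obtain qs where "entourage_walk U v qs (snd p)" "walk_cost qs = walk_cost ps" by auto
  moreover have "(snd p, u) \<in> U (fst p)" using Cons.prems assms(1)[of "fst p"] by (auto dest: symD)
  ultimately show ?case
    by (intro exI[of _ "qs @ [(fst p, u)]"]) (auto simp: entourage_walk_append)
qed

text \<open>Isolates the step during which the accumulated cost passes \<open>t\<close>; it is
  applied with \<open>t\<close> half of the total cost.\<close>

lemma walk_cost_split:
  assumes "0 \<le> t" "t < walk_cost ps"
  shows "\<exists>qs p rs. ps = qs @ p # rs \<and> walk_cost qs \<le> t \<and> t < walk_cost qs + (1 / 2) ^ fst p"
  using assms
proof (induction ps arbitrary: t)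
  case (Cons p ps)
  show ?case
  proof (cases "t < (1 / 2) ^ fst p")
    case True
    then show ?thesis using Cons.prems by (intro exI[of _ "[]"]) auto
  next
    case False
    then obtain qs q rs where "ps = qs @ q # rs" "walk_cost qs \<le> t - (1 / 2) ^ fst p"
      "t - (1 / 2) ^ fst p < walk_cost qs + (1 / 2) ^ fst q"
      using Cons.IH[of "t - (1 / 2) ^ fst p"] Cons.prems by auto
    then show ?thesis by (intro exI[of _ "p # qs"] exI[of _ q] exI[of _ rs]) auto
  qed
qed simp

text \<open>The setting of the metrization lemma. By \<open>U_0\<close> any two points of
  \<open>A\<close> are joined by a single step, so the infimum of costs is taken over a nonempty
  set; \<open>U_separating\<close> turns the resulting pseudometric into a metric.\<close>

locale entourage_sequence =
  fixes A :: "'a set" and U :: "nat \<Rightarrow> ('a \<times> 'a) set"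
  assumes U_0: "U 0 = A \<times> A"
    and U_refl: "Id_on A \<subseteq> U i"
    and U_sym: "sym (U i)"
    and U_cube: "U (Suc i) ^^ 3 \<subseteq> U i"
    and U_separating: "(\<And>i. (u, v) \<in> U i) \<Longrightarrow> u = v"
begin

lemma U_subset: "U i \<subseteq> A \<times> A" and U_Suc: "U (Suc i) \<subseteq> U i"
proof -
  have *: "U (Suc i) \<subseteq> U i" if "U (Suc i) \<subseteq> A \<times> A" for i
  proof clarify
    fix u v assume "(u, v) \<in> U (Suc i)"
    moreover from this that have "(v, v) \<in> U (Suc i)" using U_refl[of "Suc i"] by auto
    ultimately have "(u, v) \<in> U (Suc i) ^^ 3" by (auto simp: numeral_3_eq_3)
    then show "(u, v) \<in> U i" using U_cube by blast
  qed
  \<comment> \<open>Reflexivity is available only at points of \<open>A\<close>, so the endpoints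
    are first located by the walk from \<open>u\<close> to \<open>v\<close>, back to
    \<open>u\<close> and again to \<open>v\<close>, which exists by symmetry.\<close>
  have **: "U i \<subseteq> A \<times> A" for i
  proof (induction i)
    case (Suc i)
    have "U (Suc i) \<subseteq> A \<times> A"
    proof clarify
      fix u v assume uv: "(u, v) \<in> U (Suc i)"
      then have "(v, u) \<in> U (Suc i)" using U_sym[of "Suc i"] by (auto dest: symD)
      then have "(u, v) \<in> U (Suc i) ^^ 3" using uv by (auto simp: numeral_3_eq_3)
      then show "u \<in> A \<and> v \<in> A" using U_cube[of i] Suc.IH by auto
    qed
    then show ?case .
  qed (simp add: U_0)
  show "U i \<subseteq> A \<times> A" "U (Suc i) \<subseteq> U i" using * ** by blast+
qed

lemma U_antimono: "i \<le> j \<Longrightarrow> U j \<subseteq> U i"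
  using U_Suc by (rule lift_Suc_antimono_le)

lemma entourage_walk_in: "\<lbrakk>entourage_walk U u ps v; u \<in> A\<rbrakk> \<Longrightarrow> v \<in> A"
  using U_subset by (induction ps arbitrary: u) auto

text \<open>The step at which the accumulated cost passes one half of the total splits the walk into two
  cheap walks and a single step, to which the inclusion of cubes applies.\<close>

lemma cheap_walk:
  assumes "entourage_walk U u ps v" "u \<in> A" "walk_cost ps < (1 / 2) ^ Suc i"
  shows "(u, v) \<in> U i"
  using assms
proof (induction "length ps" arbitrary: u v ps i rule: less_induct)
  case less
  show ?case
  proof (cases "ps = []")
    case True
    then show ?thesis using less.prems U_refl by auto
  next
    case False
    define t where "t = walk_cost ps / 2"
    have "0 < walk_cost ps"
      using False by (cases ps) (simp_all add: add_pos_nonneg walk_cost_nonneg)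
    then have t: "0 \<le> t" "t < walk_cost ps" by (auto simp: t_def)
    obtain qs p rs where ps: "ps = qs @ p # rs" "walk_cost qs \<le> t" "t < walk_cost qs + (1 / 2) ^ fst p"
      using walk_cost_split[OF t] by (elim exE conjE) (rule that)
    obtain w where w: "entourage_walk U u qs w" "(w, snd p) \<in> U (fst p)"
      "entourage_walk U (snd p) rs v"
      using less.prems(1) by (auto simp: ps(1) entourage_walk_append)
    have A: "w \<in> A" "snd p \<in> A" using w(2) U_subset by blast+
    have total: "walk_cost ps = walk_cost qs + (1 / 2) ^ fst p + walk_cost rs" using ps(1) by simp
    show ?thesis
    proof (cases i)
      case 0
      then show ?thesis using less.prems entourage_walk_in by (auto simp: U_0)
    next
      case (Suc j)
      \<comment> \<open>Both outer walks cost at most \<open>t\<close>: the first by the choice of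
        the split, the last because the first two pieces together cost more than \<open>t\<close>,
        half of the total. The middle step costs less than \<open>(1 / 2) ^ Suc i\<close>. Hence all
        three pieces lie in \<open>U (Suc i)\<close>.\<close>
      have t_less: "t < (1 / 2) ^ Suc (Suc i)" using less.prems(3) by (simp add: t_def)
      have "(u, w) \<in> U (Suc i)"
        by (rule less.hyps[OF _ w(1) less.prems(2)]) (use ps(1,2) t_less in auto)
      moreover have "(snd p, v) \<in> U (Suc i)"
        by (rule less.hyps[OF _ w(3) A(2)]) (use ps total t_less in \<open>auto simp: t_def\<close>)
      moreover have "(1 / 2 :: real) ^ fst p < (1 / 2) ^ Suc i"
        using total less.prems(3) walk_cost_nonneg[of qs] walk_cost_nonneg[of rs] by linarith
      then have "Suc i \<le> fst p" by (subst (asm) power_strict_decreasing_iff) auto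
      then have "(w, snd p) \<in> U (Suc i)" using w(2) U_antimono by blast
      ultimately have "(u, v) \<in> U (Suc i) ^^ 3" by (auto simp: numeral_3_eq_3)
      then show ?thesis using U_cube by blast
    qed
  qed
qed

text \<open>\<open>Metric_space\<close> demands nonnegativity and symmetry at all points of the
  type; the default 0 outside \<open>A\<close> provides both.\<close>

definition walk_dist :: "'a \<Rightarrow> 'a \<Rightarrow> real" where
  "walk_dist u v =
     (if u \<in> A \<and> v \<in> A then Inf (walk_cost ` {ps. entourage_walk U u ps v}) else 0)"

lemma walk_dist_le:
  assumes "entourage_walk U u ps v" "u \<in> A"
  shows "walk_dist u v \<le> walk_cost ps"
proof -
  have "bdd_below (walk_cost ` {ps. entourage_walk U u ps v})"
    using walk_cost_nonneg by (intro bdd_belowI[of _ 0]) auto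
  then show ?thesis
    using assms entourage_walk_in[OF assms] unfolding walk_dist_def by (auto intro: cInf_lower)
qed

lemma walk_dist_less:
  assumes "u \<in> A" "v \<in> A" "walk_dist u v < r"
  obtains ps where "entourage_walk U u ps v" "walk_cost ps < r"
proof -
  have "entourage_walk U u [(0, v)] v" using assms(1,2) by (simp add: U_0)
  then have "walk_cost ` {ps. entourage_walk U u ps v} \<noteq> {}" by blast
  then show ?thesis
    using assms that cInf_lessD[of "walk_cost ` {ps. entourage_walk U u ps v}" r]
    unfolding walk_dist_def by auto
qed

lemma walk_dist_U: "(u, v) \<in> U i \<Longrightarrow> walk_dist u v \<le> (1 / 2) ^ i"
  using walk_dist_le[of u "[(i, v)]" v] U_subset by auto

text \<open>Together with \<open>walk_dist_U\<close> this places \<open>U i\<close> between the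
  metric tubes of radii \<open>2 ^ -(i + 1)\<close> and \<open>2 ^ -i\<close>.\<close>

lemma U_if_walk_dist_less:
  assumes "u \<in> A" "v \<in> A" "walk_dist u v < (1 / 2) ^ Suc i"
  shows "(u, v) \<in> U i"
  using walk_dist_less[OF assms] cheap_walk assms(1) by metis

lemma walk_dist_nonneg: "0 \<le> walk_dist u v"
proof (cases "u \<in> A \<and> v \<in> A")
  case True
  show ?thesis
  proof (rule ccontr)
    assume "\<not> 0 \<le> walk_dist u v"
    then obtain ps where "entourage_walk U u ps v" "walk_cost ps < 0"
      using True walk_dist_less[of u v 0] by (metis not_le)
    then show False using walk_cost_nonneg[of ps] by simp
  qed
qed (auto simp: walk_dist_def)

lemma walk_dist_commute_le: "walk_dist u v \<le> walk_dist v u"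
proof (cases "u \<in> A \<and> v \<in> A")
  case True
  show ?thesis
  proof (rule field_le_epsilon)
    fix e :: real assume "0 < e"
    then have "walk_dist v u < walk_dist v u + e" by simp
    then obtain ps where ps: "entourage_walk U v ps u" "walk_cost ps < walk_dist v u + e"
      using walk_dist_less[of v u "walk_dist v u + e"] True by blast
    obtain qs where "entourage_walk U u qs v" "walk_cost qs = walk_cost ps"
      using entourage_walk_sym[OF U_sym ps(1)] by blast
    then show "walk_dist u v \<le> walk_dist v u + e"
      using walk_dist_le[of u qs v] True ps(2) by linarith
  qed
qed (auto simp: walk_dist_def)

lemma walk_dist_triangle:
  assumes "u \<in> A" "v \<in> A" "w \<in> A"
  shows "walk_dist u w \<le> walk_dist u v + walk_dist v w"
proof (rule field_le_epsilon)
  fix e :: real assume "0 < e"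
  then have *: "walk_dist u v < walk_dist u v + e / 2" "walk_dist v w < walk_dist v w + e / 2"
    by simp_all
  obtain ps where ps: "entourage_walk U u ps v" "walk_cost ps < walk_dist u v + e / 2"
    using walk_dist_less[OF assms(1,2) *(1)] .
  obtain qs where qs: "entourage_walk U v qs w" "walk_cost qs < walk_dist v w + e / 2"
    using walk_dist_less[OF assms(2,3) *(2)] .
  have "entourage_walk U u (ps @ qs) w" using ps(1) qs(1) unfolding entourage_walk_append by blast
  from walk_dist_le[OF this assms(1)] ps(2) qs(2)
  show "walk_dist u w \<le> walk_dist u v + walk_dist v w + e" by simp
qed

lemma Metric_space_walk_dist: "Metric_space A walk_dist"
proof
  fix u v assume uv: "u \<in> A" "v \<in> A"
  show "walk_dist u v = 0 \<longleftrightarrow> u = v"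
  proof
    assume "walk_dist u v = 0"
    then show "u = v" using U_if_walk_dist_less[OF uv] by (intro U_separating) simp
  next
    assume "u = v"
    then show "walk_dist u v = 0"
      using walk_dist_le[of u "[]" v] uv walk_dist_nonneg[of u v] by simp
  qed
next
  show "walk_dist u v = walk_dist v u" for u v
    using walk_dist_commute_le by (rule antisym) (rule walk_dist_commute_le)
qed (fact walk_dist_nonneg walk_dist_triangle)+

end

text \<open>The sets \<open>U i\<close> form a base of the neighborhoods of the diagonal and are
  interleaved with the tubes of \<open>walk_dist\<close>, so sections of the \<open>U i\<close> fit
  into balls and small balls into open sets.\<close>

lemma compatible_metric_of_entourages:
  assumes t1: "t1_space X"
    and U: "U 0 = topspace X \<times> topspace X" "\<And>i. diag_nbhd X (U i)" "\<And>i. sym (U i)"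
      "\<And>i. U (Suc i) ^^ 3 \<subseteq> U i"
    and base: "\<And>W. diag_nbhd X W \<Longrightarrow> \<exists>i. U i \<subseteq> W"
  obtains d where "d \<in> compatible_metrics X" "\<And>u v i. (u, v) \<in> U i \<Longrightarrow> d u v \<le> (1 / 2) ^ i"
proof -
  let ?A = "topspace X"
  \<comment> \<open>Membership of \<open>(p, q)\<close> in this set only restricts \<open>q\<close>
    when \<open>p = u\<close>, so an entourage inside it has its section at \<open>u\<close> inside
    \<open>S\<close>. It is open because points are closed. With \<open>S\<close> the complement of
    a point it separates points; with general \<open>S\<close> it compares the topologies.\<close>
  have nbhd: "diag_nbhd X ((?A - {u}) \<times> ?A \<union> ?A \<times> S)" if "openin X S" "u \<in> S" for u S
  proof -
    have "openin X (?A - {u})"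
      using that openin_subset[OF that(1)] closedin_t1_singleton[OF t1, of u]
      by (intro openin_diff) auto
    then have "openin (prod_topology X X) ((?A - {u}) \<times> ?A \<union> ?A \<times> S)"
      using that by (intro openin_Un) (simp_all add: openin_prod_Times_iff)
    moreover have "Id_on ?A \<subseteq> (?A - {u}) \<times> ?A \<union> ?A \<times> S" using that(2) by auto
    moreover have "(?A - {u}) \<times> ?A \<union> ?A \<times> S \<subseteq> ?A \<times> ?A"
      using openin_subset[OF that(1)] by auto
    ultimately show ?thesis unfolding diag_nbhd_def by blast
  qed
  interpret entourage_sequence ?A U
  proof
    fix u v assume uv: "\<And>i. (u, v) \<in> U i"
    show "u = v"
    proof (rule ccontr)
      assume "u \<noteq> v"
      have "u \<in> ?A" "v \<in> ?A" using uv[of 0] U(1) by auto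
      then have "openin X (?A - {v})" using closedin_t1_singleton[OF t1, of v]
        by (intro openin_diff) auto
      then obtain i where "U i \<subseteq> (?A - {u}) \<times> ?A \<union> ?A \<times> (?A - {v})"
        using base[OF nbhd[of "?A - {v}" u]] \<open>u \<noteq> v\<close> \<open>u \<in> ?A\<close> by blast
      then show False using uv[of i] by blast
    qed
  qed (fact U diag_nbhd_refl[OF U(2)])+
  interpret Metric_space ?A walk_dist by (rule Metric_space_walk_dist)
  have "openin mtopology S \<longleftrightarrow> openin X S" for S
  proof
    assume S: "openin mtopology S"
    show "openin X S"
    proof (subst openin_subopen, intro ballI)
      fix x assume x: "x \<in> S"
      then obtain r where r: "r > 0" "mball x r \<subseteq> S" "x \<in> ?A"
        using S unfolding openin_mtopology by blast
      obtain i where i: "(1 / 2 :: real) ^ i < r"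
        using real_arch_pow_inv[OF r(1), of "1/2"] by auto
      obtain T where T: "openin (prod_topology X X) T" "Id_on ?A \<subseteq> T" "T \<subseteq> U i"
        using U(2)[of i] unfolding diag_nbhd_def by blast
      have "(x, x) \<in> T" using T(2) r(3) by auto
      then obtain P Q where PQ: "openin X P" "openin X Q" "x \<in> P" "x \<in> Q" "P \<times> Q \<subseteq> T"
        using T(1) unfolding openin_prod_topology_alt by meson
      have "Q \<subseteq> S"
      proof
        fix y assume y: "y \<in> Q"
        then have "(x, y) \<in> U i" using PQ T(3) by blast
        then have "walk_dist x y < r" "y \<in> ?A" using walk_dist_U[of x y i] i U_subset by auto
        then show "y \<in> S" using r by auto
      qed
      then show "\<exists>T. openin X T \<and> x \<in> T \<and> T \<subseteq> S" using PQ by blast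
    qed
  next
    assume S: "openin X S"
    show "openin mtopology S"
      unfolding openin_mtopology
    proof (intro conjI allI impI)
      fix x assume x: "x \<in> S"
      then obtain i where i: "U i \<subseteq> (?A - {x}) \<times> ?A \<union> ?A \<times> S" using base[OF nbhd[OF S]] by blast
      have "mball x ((1 / 2) ^ Suc i) \<subseteq> S" using U_if_walk_dist_less[of x _ i] i by fastforce
      then show "\<exists>r>0. mball x r \<subseteq> S" by (intro exI[of _ "(1 / 2) ^ Suc i"]) simp
    qed (use openin_subset[OF S] in auto)
  qed
  then have "mtopology = X" by (simp add: topology_eq)
  then have "walk_dist \<in> compatible_metrics X"
    using Metric_space_axioms by (simp add: compatible_metrics_iff)
  then show ?thesis using that walk_dist_U by blast
qed

section \<open>Chains and their gaps\<close>

definition chain_gap :: "'a \<Rightarrow> 'a \<Rightarrow> nat \<Rightarrow> (nat \<Rightarrow> 'a) \<Rightarrow> (nat \<Rightarrow> 'a) \<Rightarrow> nat \<Rightarrow> 'a \<times> 'a" where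
  "chain_gap x y n a b i = (if i = 0 then x else b i, if i = n then y else a (Suc i))"

lemma atMost_chain: "1 \<le> n \<Longrightarrow> {..n} = insert 0 (insert n {1..<n})" for n :: nat
  by auto

text \<open>With the two end gaps indexed by 0 and \<open>n\<close>, the chain condition becomes one
  inclusion of a finite set, which can be achieved by adding gaps to a neighborhood.\<close>

lemma nbhd_chain_iff_gaps:
  "nbhd_chain f V x y n a b \<longleftrightarrow>
     1 \<le> n \<and> (\<forall>i\<in>{1..n}. (a i, b i) \<in> f) \<and> chain_gap x y n a b ` {..n} \<subseteq> V"
proof (cases "1 \<le> n")
  case True
  have "(\<forall>i\<in>{1..<n}. (b i, a (i + 1)) \<in> V) \<longleftrightarrow> (\<forall>i\<in>{1..<n}. chain_gap x y n a b i \<in> V)"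
    by (intro ball_cong) (auto simp: chain_gap_def)
  then show ?thesis using True
    unfolding nbhd_chain_def atMost_chain[OF True] by (auto simp: chain_gap_def)
qed (simp add: nbhd_chain_def)

lemma sum_chain_gap:
  assumes "1 \<le> n"
  shows "(\<Sum>i\<le>n. d (fst (chain_gap x y n a b i)) (snd (chain_gap x y n a b i))) =
    d x (a 1) + (\<Sum>i=1..<n. d (b i) (a (i + 1))) + d (b n) y"
proof -
  have "(\<Sum>i=1..<n. d (fst (chain_gap x y n a b i)) (snd (chain_gap x y n a b i))) =
      (\<Sum>i=1..<n. d (b i) (a (i + 1)))"
    by (intro sum.cong) (auto simp: chain_gap_def)
  then show ?thesis using assms
    unfolding atMost_chain[OF assms] by (simp add: chain_gap_def add_ac)
qed

lemma chain_gap_in_space: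
  assumes "f \<subseteq> A \<times> A" "\<forall>i\<in>{1..n}. (a i, b i) \<in> f" "x \<in> A" "y \<in> A"
  shows "chain_gap x y n a b ` {..n} \<subseteq> A \<times> A"
proof clarify
  fix i u v assume "i \<le> n" "(u, v) = chain_gap x y n a b i"
  moreover have "a j \<in> A \<and> b j \<in> A" if "j \<in> {1..n}" for j using assms(1,2) that by blast
  ultimately show "u \<in> A \<and> v \<in> A"
    using assms(3,4) by (auto simp: chain_gap_def)
qed

section \<open>Enlarged neighborhoods: the first inclusion, closedness and composition\<close>

lemma W_relE:
  assumes "(x, y) \<in> W_rel X f" "diag_nbhd X W"
  obtains V n a b where "diag_nbhd X V" "closedin (prod_topology X X) V" "sym V"
    "nbhd_chain f V x y n a b" "V ^^ (3 ^ n) \<subseteq> W"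
  using assms unfolding W_rel_def by blast

text \<open>To find an \<open>xy,V\<close> chain it is enough to enlarge a controlled neighborhood \<open>R\<close> by those gaps
  \<open>E\<close> of a chain which \<open>R\<close> does not cover.\<close>

lemma W_relI:
  assumes X: "compact_space X" and d: "d \<in> compatible_metrics X"
    and xy: "x \<in> topspace X" "y \<in> topspace X"
    and chain: "\<And>\<eta>. 0 < \<eta> \<Longrightarrow> \<exists>n a b R E (\<delta>::real) M C. 1 \<le> n \<and> (\<forall>i\<in>{1..n}. (a i, b i) \<in> f) \<and>
      chain_gap x y n a b ` {..n} \<subseteq> R \<union> E \<and>
      diag_nbhd X R \<and> closedin (prod_topology X X) R \<and> sym R \<and>
      finite E \<and> E \<subseteq> topspace X \<times> topspace X \<and>
      0 < M \<and> (\<forall>(u, v) \<in> R ^^ M. d u v \<le> \<delta>) \<and> 3 ^ n \<le> C * M \<and>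
      (\<Sum>(u, v)\<in>E. d u v) + (real (card E) + real C + 1) * \<delta> < \<eta>"
  shows "(x, y) \<in> W_rel X f"
proof -
  have ms: "Metric_space (topspace X) d" using d by (simp add: compatible_metrics_iff)
  have mz: "metrizable_space X"
    using d unfolding compatible_metrics_iff metrizable_space_def by metis
  show ?thesis
    unfolding W_rel_def
  proof (clarsimp simp: xy)
    fix W assume "diag_nbhd X W"
    then obtain \<eta> where \<eta>: "0 < \<eta>"
      "\<And>u v. \<lbrakk>u \<in> topspace X; v \<in> topspace X; d u v < \<eta>\<rbrakk> \<Longrightarrow> (u, v) \<in> W"
      using diag_nbhd_metric_ball[OF X d] by blast
    obtain n a b R E M C and \<delta> :: real where n: "1 \<le> n" "\<forall>i\<in>{1..n}. (a i, b i) \<in> f"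
      "chain_gap x y n a b ` {..n} \<subseteq> R \<union> E"
      and R: "diag_nbhd X R" "closedin (prod_topology X X) R" "sym R"
      and E: "finite E" "E \<subseteq> topspace X \<times> topspace X"
      and M: "0 < M" "\<forall>(u, v) \<in> R ^^ M. d u v \<le> \<delta>" "3 ^ n \<le> C * M"
      and less: "(\<Sum>(u, v)\<in>E. d u v) + (real (card E) + real C + 1) * \<delta> < \<eta>"
      using chain[OF \<eta>(1)] by (elim exE conjE) (rule that)
    define V where "V = R \<union> E \<union> E\<inverse>"
    note V = extended_diag_nbhd[OF mz R E, folded V_def]
    have "V ^^ (3 ^ n) \<subseteq> W"
    proof clarify
      fix p q assume pq: "(p, q) \<in> V ^^ (3 ^ n)"
      then have A: "p \<in> topspace X" "q \<in> topspace X"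
        using relpow_subset_Times[OF diag_nbhd_subset[OF V(1)], of "3 ^ n"] by auto
      have "d p q \<le> (\<Sum>(u, v)\<in>E. d u v) + (real (card E) + real C + 1) * \<delta>"
        using relpow_extended_metric_bound[OF ms diag_nbhd_refl[OF R(1)] diag_nbhd_subset[OF R(1)]
            M(1) _ E A(1) pq[unfolded V_def] M(3), of \<delta>] M(2) by blast
      then show "(p, q) \<in> W" using \<eta>(2) A less by simp
    qed
    moreover have "nbhd_chain f V x y n a b"
      unfolding nbhd_chain_iff_gaps using n by (auto simp: V_def)
    ultimately show "\<exists>V. diag_nbhd X V \<and> closedin (prod_topology X X) V \<and> sym V \<and>
        (\<exists>n\<ge>Suc 0. (\<exists>a b. nbhd_chain f V x y n a b) \<and> V ^^ 3 ^ n \<subseteq> W)"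
      using V n(1) by auto
  qed
qed

text \<open>Here \<open>R\<close> is a metric tube whose steps are blocks of length 1, so
  \<open>C = 3 ^ n\<close>. This large constant is harmless because the metric chain fixes
  \<open>n\<close> before \<open>\<delta>\<close> is chosen.\<close>

lemma metric_chain_rel_subset_W_rel:
  assumes X: "compact_space X" and d: "d \<in> compatible_metrics X"
    and f: "f \<subseteq> topspace X \<times> topspace X"
  shows "metric_chain_rel X d f \<subseteq> W_rel X f"
proof clarify
  fix x y assume xy: "(x, y) \<in> metric_chain_rel X d f"
  have ms: "Metric_space (topspace X) d" using d by (simp add: compatible_metrics_iff)
  have A: "x \<in> topspace X" "y \<in> topspace X" using xy by (auto simp: metric_chain_rel_def)
  show "(x, y) \<in> W_rel X f"
  proof (rule W_relI[OF X d A])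
    fix \<eta> :: real assume \<eta>: "0 < \<eta>"
    then have "0 < \<eta> / 2" by simp
    then obtain n a b where n: "1 \<le> n" "\<forall>i\<in>{1..n::nat}. (a i, b i) \<in> f"
      and less: "d x (a 1) + (\<Sum>i=1..<n. d (b i) (a (i + 1))) + d (b n) y < \<eta> / 2"
      using xy unfolding metric_chain_rel_def by blast
    define E where "E = chain_gap x y n a b ` {..n}"
    \<comment> \<open>There are at most \<open>n + 1\<close> extra edges, so \<open>K\<close> bounds
      the factor of \<open>\<delta>\<close>. One half of \<open>\<eta>\<close> is left for the gaps,
      the other equals \<open>K * \<delta>\<close>.\<close>
    define K where "K = real (n + 1) + real (3 ^ n) + 1"
    define \<delta> where "\<delta> = \<eta> / 2 / K"
    define R where "R = {(u, v) \<in> topspace X \<times> topspace X. d u v \<le> \<delta>}"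
    have K: "0 < K" unfolding K_def by (rule add_nonneg_pos) simp_all
    then have \<delta>: "0 < \<delta>" using \<eta> by (simp add: \<delta>_def)
    have E: "finite E" "E \<subseteq> topspace X \<times> topspace X" "card E \<le> n + 1"
      using chain_gap_in_space[OF f n(2) A] card_image_le[of "{..n}" "chain_gap x y n a b"]
      by (auto simp: E_def)
    have "(\<Sum>(u, v)\<in>E. d u v) < \<eta> / 2"
      using sum_image_metric_le[OF ms, of "{..n}" "chain_gap x y n a b"] sum_chain_gap[OF n(1), of d x y a b]
        less by (simp add: E_def)
    moreover have "(real (card E) + real (3 ^ n) + 1) * \<delta> \<le> K * \<delta>"
      using E(3) \<delta> by (intro mult_right_mono) (auto simp: K_def)
    moreover have "K * \<delta> = \<eta> / 2" using K by (simp add: \<delta>_def)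
    ultimately have total: "(\<Sum>(u, v)\<in>E. d u v) + (real (card E) + real (3 ^ n) + 1) * \<delta> < \<eta>"
      by linarith
    have R: "diag_nbhd X R" "closedin (prod_topology X X) R" "sym R"
      using diag_nbhd_metric_le[OF d \<delta>] closedin_metric_le[OF d, of \<delta>] Metric_space.commute[OF ms]
      by (auto simp: R_def sym_def)
    have M: "0 < (1::nat)" "\<forall>(u, v) \<in> R ^^ 1. d u v \<le> \<delta>" "3 ^ n \<le> 3 ^ n * (1::nat)"
      by (auto simp: R_def)
    have cover: "chain_gap x y n a b ` {..n} \<subseteq> R \<union> E" by (simp add: E_def)
    show "\<exists>n a b R E (\<delta>::real) M C. 1 \<le> n \<and> (\<forall>i\<in>{1..n}. (a i, b i) \<in> f) \<and>
      chain_gap x y n a b ` {..n} \<subseteq> R \<union> E \<and>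
      diag_nbhd X R \<and> closedin (prod_topology X X) R \<and> sym R \<and>
      finite E \<and> E \<subseteq> topspace X \<times> topspace X \<and>
      0 < M \<and> (\<forall>(u, v) \<in> R ^^ M. d u v \<le> \<delta>) \<and> 3 ^ n \<le> C * M \<and>
      (\<Sum>(u, v)\<in>E. d u v) + (real (card E) + real C + 1) * \<delta> < \<eta>"
      by (intro exI conjI) (fact n cover R E(1,2) M total)+
  qed
qed

text \<open>For a nearby pair in \<open>W_rel\<close> the power \<open>V ^^ (3 ^ n)\<close> is
  already small, so \<open>3 ^ n\<close> steps form a single block and \<open>C = 1\<close>. Moving
  the ends of the chain costs only two extra edges, whatever \<open>n\<close> is.\<close>

lemma closedin_W_rel:
  assumes X: "compact_space X" and mz: "metrizable_space X"
    and f: "f \<subseteq> topspace X \<times> topspace X"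
  shows "closedin (prod_topology X X) (W_rel X f)"
proof -
  obtain d where d: "d \<in> compatible_metrics X" using compatible_metrics_nonempty[OF mz] .
  interpret Metric_space "topspace X" d using d by (simp add: compatible_metrics_iff)
  have top: "mtopology = X" using d by (simp add: compatible_metrics_iff)
  have "(x, y) \<in> W_rel X f" if xy: "(x, y) \<in> prod_topology X X closure_of W_rel X f" for x y
  proof -
    have A: "x \<in> topspace X" "y \<in> topspace X"
      using xy in_closure_of[of "(x, y)" "prod_topology X X"] by auto
    show ?thesis
    proof (rule W_relI[OF X d A])
      fix \<eta> :: real assume \<eta>: "0 < \<eta>"
      \<comment> \<open>The two extra edges have total length at most \<open>4 * \<delta>\<close>,
        their number contributes at most \<open>2 * \<delta>\<close> and \<open>C + 1\<close>
        another \<open>2 * \<delta>\<close>, which leaves one \<open>\<delta>\<close> to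
        spare.\<close>
      define \<delta> where "\<delta> = \<eta> / 9"
      have \<delta>: "0 < \<delta>" using \<eta> by (simp add: \<delta>_def)
      have near: "\<exists>p\<in>W_rel X f. p \<in> T" if "(x, y) \<in> T" "openin (prod_topology X X) T" for T
        using xy that by (auto simp: in_closure_of)
      have "\<exists>p\<in>W_rel X f. p \<in> mball x \<delta> \<times> mball y \<delta>"
        by (rule near) (use A \<delta> openin_mball top in \<open>simp_all add: openin_prod_Times_iff\<close>)
      then obtain x' y' where xy': "(x', y') \<in> W_rel X f" "x' \<in> mball x \<delta>" "y' \<in> mball y \<delta>"
        by auto
      obtain V n a b where V: "diag_nbhd X V" "closedin (prod_topology X X) V" "sym V"
        and chain: "nbhd_chain f V x' y' n a b"
        and VW: "V ^^ (3 ^ n) \<subseteq> {(u, v) \<in> topspace X \<times> topspace X. d u v \<le> \<delta>}"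
        using W_relE[OF xy'(1) diag_nbhd_metric_le[OF d \<delta>]] .
      have n: "1 \<le> n" "\<forall>i\<in>{1..n}. (a i, b i) \<in> f" "chain_gap x' y' n a b ` {..n} \<subseteq> V"
        using chain by (auto simp: nbhd_chain_iff_gaps)
      define E where "E = {(x, a 1), (b n, y)}"
      have "(x', a 1) \<in> V" "(b n, y') \<in> V" using chain by (auto simp: nbhd_chain_def)
      then have "d x' (a 1) \<le> \<delta>" "d (b n) y' \<le> \<delta>"
        using diag_nbhd_subset_relpow[OF V(1), of "3 ^ n"] VW by auto
      moreover have B: "a 1 \<in> topspace X" "b n \<in> topspace X" using f n(1,2) by auto
      ultimately have "d x (a 1) \<le> 2 * \<delta>" "d (b n) y \<le> 2 * \<delta>"
        using triangle[of x x' "a 1"] triangle[of "b n" y' y] xy'(2,3) commute[of y y'] by auto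
      then have "(\<Sum>(u, v)\<in>E. d u v) \<le> 4 * \<delta>"
        using \<delta> by (cases "(x, a 1) = (b n, y)") (auto simp: E_def)
      moreover have "real (card E) * \<delta> \<le> 2 * \<delta>"
        using \<delta> by (intro mult_right_mono) (auto simp: E_def card_insert_if)
      moreover have "\<eta> = 9 * \<delta>" by (simp add: \<delta>_def)
      moreover have "(real (card E) + real 1 + 1) * \<delta> = real (card E) * \<delta> + 2 * \<delta>"
        by (simp add: algebra_simps)
      ultimately have total: "(\<Sum>(u, v)\<in>E. d u v) + (real (card E) + real 1 + 1) * \<delta> < \<eta>"
        using \<delta> by linarith
      \<comment> \<open>Replacing \<open>x'\<close> and \<open>y'\<close> by \<open>x\<close> and
        \<open>y\<close> changes only the gaps 0 and \<open>n\<close>, and these are the members of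
        \<open>E\<close>.\<close>
      have cover: "chain_gap x y n a b ` {..n} \<subseteq> V \<union> E"
      proof clarify
        fix i u v assume i: "i \<le> n" "(u, v) = chain_gap x y n a b i" "(u, v) \<notin> E"
        then have "chain_gap x y n a b i = chain_gap x' y' n a b i"
          using n(1) by (auto simp: chain_gap_def E_def split: if_splits)
        then show "(u, v) \<in> V" using i n(3) by auto
      qed
      have E: "finite E" "E \<subseteq> topspace X \<times> topspace X" using A B by (auto simp: E_def)
      have M: "0 < (3::nat) ^ n" "\<forall>(u, v) \<in> V ^^ (3 ^ n). d u v \<le> \<delta>" "(3::nat) ^ n \<le> 1 * 3 ^ n"
        using VW by auto
      show "\<exists>n a b R E (\<delta>::real) M C. 1 \<le> n \<and> (\<forall>i\<in>{1..n}. (a i, b i) \<in> f) \<and>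
        chain_gap x y n a b ` {..n} \<subseteq> R \<union> E \<and>
        diag_nbhd X R \<and> closedin (prod_topology X X) R \<and> sym R \<and>
        finite E \<and> E \<subseteq> topspace X \<times> topspace X \<and>
        0 < M \<and> (\<forall>(u, v) \<in> R ^^ M. d u v \<le> \<delta>) \<and> 3 ^ n \<le> C * M \<and>
        (\<Sum>(u, v)\<in>E. d u v) + (real (card E) + real C + 1) * \<delta> < \<eta>"
        by (intro exI conjI) (fact n(1,2) cover V E M total)+
    qed
  qed
  moreover have "W_rel X f \<subseteq> topspace (prod_topology X X)" by (auto simp: W_rel_def)
  ultimately show ?thesis
    using closure_of_subset_eq[of "W_rel X f" "prod_topology X X"] by auto
qed

text \<open>This serves transitivity. The length \<open>n\<close> of the second chain is known only
  after \<open>\<delta>\<close>, but \<open>3 ^ (m + n)\<close> steps make \<open>3 ^ m\<close>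
  blocks of length \<open>3 ^ n\<close>, and \<open>C = 3 ^ m\<close> is known beforehand.\<close>

lemma metric_chain_rel_W_rel_comp:
  assumes X: "compact_space X" and d: "d \<in> compatible_metrics X"
    and f: "f \<subseteq> topspace X \<times> topspace X"
    and xy: "(x, y) \<in> metric_chain_rel X d f" and yz: "(y, z) \<in> W_rel X f"
  shows "(x, z) \<in> W_rel X f"
proof -
  interpret Metric_space "topspace X" d using d by (simp add: compatible_metrics_iff)
  have A: "x \<in> topspace X" "y \<in> topspace X" "z \<in> topspace X"
    using xy yz by (auto simp: metric_chain_rel_def W_rel_def)
  show ?thesis
  proof (rule W_relI[OF X d A(1,3)])
    fix \<eta> :: real assume \<eta>: "0 < \<eta>"
    then have "0 < \<eta> / 2" by simp
    then obtain m a b where m: "1 \<le> m" "\<forall>i\<in>{1..m::nat}. (a i, b i) \<in> f"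
      and less: "d x (a 1) + (\<Sum>i=1..<m. d (b i) (a (i + 1))) + d (b m) y < \<eta> / 2"
      using xy unfolding metric_chain_rel_def by blast
    \<comment> \<open>\<open>K - 1\<close> bounds the factor of \<open>\<delta>\<close>; the
      remaining \<open>\<delta>\<close> pays for ending the first chain at \<open>a' 1\<close>, the
      start of the second, instead of at \<open>y\<close>.\<close>
    define K where "K = real (m + 1) + real (3 ^ m) + 2"
    define \<delta> where "\<delta> = \<eta> / 2 / K"
    have K: "0 < K" unfolding K_def by (rule add_nonneg_pos) simp_all
    then have \<delta>: "0 < \<delta>" using \<eta> by (simp add: \<delta>_def)
    obtain V n a' b' where V: "diag_nbhd X V" "closedin (prod_topology X X) V" "sym V"
      and chain: "nbhd_chain f V y z n a' b'"
      and VW: "V ^^ (3 ^ n) \<subseteq> {(u, v) \<in> topspace X \<times> topspace X. d u v \<le> \<delta>}"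
      using W_relE[OF yz diag_nbhd_metric_le[OF d \<delta>]] .
    have n: "1 \<le> n" "\<forall>i\<in>{1..n}. (a' i, b' i) \<in> f" "chain_gap y z n a' b' ` {..n} \<subseteq> V"
      using chain by (auto simp: nbhd_chain_iff_gaps)
    have B: "a' 1 \<in> topspace X" "b m \<in> topspace X" using f n(1,2) m by auto
    have "(y, a' 1) \<in> V" using chain by (auto simp: nbhd_chain_def)
    then have "d y (a' 1) \<le> \<delta>" using diag_nbhd_subset_relpow[OF V(1), of "3 ^ n"] VW by auto
    then have le: "d (b m) (a' 1) \<le> d (b m) y + \<delta>" using triangle[of "b m" y "a' 1"] A B by simp
    define E where "E = chain_gap x (a' 1) m a b ` {..m}"
    have E: "finite E" "E \<subseteq> topspace X \<times> topspace X" "card E \<le> m + 1"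
      using chain_gap_in_space[OF f m(2) A(1) B(1)]
        card_image_le[of "{..m}" "chain_gap x (a' 1) m a b"]
      by (auto simp: E_def)
    have "(\<Sum>(u, v)\<in>E. d u v) < \<eta> / 2 + \<delta>"
      using sum_image_metric_le[OF Metric_space_axioms, of "{..m}" "chain_gap x (a' 1) m a b"]
        sum_chain_gap[OF m(1), of d x "a' 1" a b] less le by (simp add: E_def)
    moreover have "(real (card E) + real (3 ^ m) + 1) * \<delta> \<le> (K - 1) * \<delta>"
      using E(3) \<delta> by (intro mult_right_mono) (auto simp: K_def)
    moreover have "K * \<delta> = \<eta> / 2" using K by (simp add: \<delta>_def)
    ultimately have total:
      "(\<Sum>(u, v)\<in>E. d u v) + (real (card E) + real (3 ^ m) + 1) * \<delta> < \<eta>"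
      by (simp add: left_diff_distrib)
    define a'' where "a'' i = (if i \<le> m then a i else a' (i - m))" for i
    define b'' where "b'' i = (if i \<le> m then b i else b' (i - m))" for i
    have cover: "chain_gap x z (m + n) a'' b'' ` {..m + n} \<subseteq> V \<union> E"
    proof clarify
      fix i u v assume i: "i \<le> m + n" "(u, v) = chain_gap x z (m + n) a'' b'' i" "(u, v) \<notin> E"
      show "(u, v) \<in> V"
      proof (cases "i \<le> m")
        case True
        then have "chain_gap x z (m + n) a'' b'' i = chain_gap x (a' 1) m a b i"
          using n(1) by (auto simp: chain_gap_def a''_def b''_def)
        then show ?thesis using i True by (auto simp: E_def)
      next
        case False
        then have "chain_gap x z (m + n) a'' b'' i = chain_gap y z n a' b' (i - m)"
          by (auto simp: chain_gap_def a''_def b''_def Suc_diff_le)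
        then show ?thesis using i n(3) False by auto
      qed
    qed
    have mn: "1 \<le> m + n" "\<forall>i\<in>{1..m + n}. (a'' i, b'' i) \<in> f"
      using m by (auto simp: a''_def b''_def intro!: bspec[OF n(2)])
    have M: "0 < (3::nat) ^ n" "\<forall>(u, v) \<in> V ^^ (3 ^ n). d u v \<le> \<delta>"
      "(3::nat) ^ (m + n) \<le> 3 ^ m * 3 ^ n"
      using VW by (auto simp: power_add)
    show "\<exists>n a b R E (\<delta>::real) M C. 1 \<le> n \<and> (\<forall>i\<in>{1..n}. (a i, b i) \<in> f) \<and>
      chain_gap x z n a b ` {..n} \<subseteq> R \<union> E \<and>
      diag_nbhd X R \<and> closedin (prod_topology X X) R \<and> sym R \<and>
      finite E \<and> E \<subseteq> topspace X \<times> topspace X \<and>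
      0 < M \<and> (\<forall>(u, v) \<in> R ^^ M. d u v \<le> \<delta>) \<and> 3 ^ n \<le> C * M \<and>
      (\<Sum>(u, v)\<in>E. d u v) + (real (card E) + real C + 1) * \<delta> < \<eta>"
      by (intro exI conjI) (fact mn cover V E(1,2) M total)+
  qed
qed

section \<open>A compatible metric for a given pair in \<open>W_rel\<close>\<close>

lemma W_rel_metric:
  assumes X: "compact_space X" and mz: "metrizable_space X" and xy: "(x, y) \<in> W_rel X f"
  obtains d where "d \<in> compatible_metrics X" "(x, y) \<in> metric_chain_rel X d f"
proof -
  obtain \<rho> where \<rho>: "\<rho> \<in> compatible_metrics X" using compatible_metrics_nonempty[OF mz] .
  let ?A = "topspace X"
  \<comment> \<open>Forcing the powers into these shrinking tubes makes the neighborhoods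
    \<open>V k\<close> a base at the diagonal.\<close>
  define B where "B k = {(u, v) \<in> ?A \<times> ?A. \<rho> u v \<le> 1 / real (Suc k)}" for k
  \<comment> \<open>The prescribed start gives \<open>U 0\<close> the value that the metrization
    lemma requires.\<close>
  define P where "P k S \<longleftrightarrow> diag_nbhd X (fst S) \<and> sym (fst S) \<and>
      (k = 0 \<longrightarrow> S = (?A \<times> ?A, 0))" for k :: nat and S :: "('a \<times> 'a) set \<times> nat"
  define Q where "Q k S T \<longleftrightarrow> 1 \<le> snd T \<and> (\<exists>a b. nbhd_chain f (fst T) x y (snd T) a b) \<and>
      fst T ^^ (3 ^ snd T) \<subseteq> fst S \<inter> B k" for k and S T :: "('a \<times> 'a) set \<times> nat"
  have "\<exists>S. \<forall>k. P k (S k) \<and> Q k (S k) (S (Suc k))"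
  proof (rule dependent_nat_choice)
    have "openin (prod_topology X X) (?A \<times> ?A)" by (simp add: openin_prod_Times_iff)
    then have "diag_nbhd X (?A \<times> ?A)" unfolding diag_nbhd_def by blast
    then show "\<exists>S. P 0 S"
      unfolding P_def by (intro exI[of _ "(?A \<times> ?A, 0)"]) (simp add: sym_def)
  next
    fix S k assume "P k S"
    then have nbhd: "diag_nbhd X (fst S \<inter> B k)"
      unfolding P_def B_def by (intro diag_nbhd_Int diag_nbhd_metric_le[OF \<rho>]) simp_all
    obtain V n a b where "diag_nbhd X V" "closedin (prod_topology X X) V" "sym V"
      "nbhd_chain f V x y n a b" "V ^^ (3 ^ n) \<subseteq> fst S \<inter> B k"
      using W_relE[OF xy nbhd] .
    then have "P (Suc k) (V, n) \<and> Q k S (V, n)" by (auto simp: P_def Q_def nbhd_chain_def)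
    then show "\<exists>T. P (Suc k) T \<and> Q k S T" by blast
  qed
  then obtain S where S: "\<And>k. P k (S k)" "\<And>k. Q k (S k) (S (Suc k))" by blast
  define V where "V k = fst (S k)" for k
  define n where "n k = snd (S k)" for k
  have V: "diag_nbhd X (V k)" "sym (V k)" for k using S(1)[of k] by (auto simp: P_def V_def)
  have V0: "V 0 = ?A \<times> ?A" "n 0 = 0" using S(1)[of 0] by (auto simp: P_def V_def n_def)
  have Suc: "1 \<le> n (Suc k)" "\<exists>a b. nbhd_chain f (V (Suc k)) x y (n (Suc k)) a b"
    "V (Suc k) ^^ (3 ^ n (Suc k)) \<subseteq> V k \<inter> B k" for k
    using S(2)[of k] by (auto simp: Q_def V_def n_def)
  define N where "N k = (\<Sum>i\<le>k. n i)" for k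
  have N_Suc: "N (Suc k) = N k + n (Suc k)" for k by (simp add: N_def)
  have N_mono: "strict_mono N" unfolding strict_mono_Suc_iff
    using N_Suc Suc(1) by (metis less_add_same_cancel1 less_le_trans zero_less_one)
  have N0: "N 0 = 0" using V0 by (simp add: N_def)
  have N_ge: "k \<le> N k" for k using strict_mono_imp_increasing[OF N_mono] .
  \<comment> \<open>Position \<open>N k\<close> of the sequence \<open>U\<close> is reserved for
    \<open>V k\<close>, and \<open>N (\<kappa> i)\<close> is the first reserved position not before
    \<open>i\<close>. Stepping back from it to \<open>i\<close> takes one cube per position, whence
    the exponent in \<open>U i\<close>.\<close>
  define \<kappa> where "\<kappa> i = (LEAST k. i \<le> N k)" for i
  have \<kappa>: "i \<le> N (\<kappa> i)" for i unfolding \<kappa>_def using N_ge by (rule LeastI)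
  have \<kappa>_le: "\<kappa> i \<le> k" if "i \<le> N k" for i k unfolding \<kappa>_def using that by (rule Least_le)
  have \<kappa>_N: "\<kappa> (N k) = k" for k
    using \<kappa>[of "N k"] \<kappa>_le[of "N k" k] strict_mono_less_eq[OF N_mono] by (simp add: antisym)
  define U where "U i = V (\<kappa> i) ^^ (3 ^ (N (\<kappa> i) - i))" for i
  have U_N: "U (N k) = V k" for k by (simp add: U_def \<kappa>_N)
  have "t1_space X" using mz by (rule metrizable_imp_t1_space)
  moreover have "U 0 = ?A \<times> ?A" using U_N[of 0] N0 V0 by simp
  moreover have "diag_nbhd X (U i)" "sym (U i)" for i
    unfolding U_def using V by (auto intro: diag_nbhd_relpow sym_relpow)
  moreover have "U (Suc i) ^^ 3 \<subseteq> U i" for i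
  proof -
    let ?k = "\<kappa> i"
    have pow: "U (Suc i) ^^ 3 = V (\<kappa> (Suc i)) ^^ (3 ^ Suc (N (\<kappa> (Suc i)) - Suc i))"
      unfolding U_def by (simp only: relpow_power_mult[symmetric] power_Suc2)
    show ?thesis
    proof (cases "Suc i \<le> N ?k")
      case True
      have "?k \<le> \<kappa> (Suc i)" using \<kappa>_le \<kappa>[of "Suc i"] Suc_leD by blast
      then have "\<kappa> (Suc i) = ?k" using \<kappa>_le[OF True] by simp
      then show ?thesis using pow True by (simp add: U_def Suc_diff_Suc del: power_Suc)
    next
      case False
      \<comment> \<open>At the reserved position \<open>N ?k\<close> the cube of the next entourage
        is the full power of \<open>V (Suc ?k)\<close> with exponent \<open>3 ^ n (Suc ?k)\<close>,
        which lies in \<open>V ?k\<close> by construction.\<close>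
      then have i: "i = N ?k" using \<kappa>[of i] by simp
      have "\<kappa> (Suc i) \<le> Suc ?k" using \<kappa>_le i N_Suc Suc(1) by (metis Suc_eq_plus1 add_left_mono)
      moreover have "?k < \<kappa> (Suc i)"
        using \<kappa>[of "Suc i"] i strict_mono_less[OF N_mono] by (metis Suc_le_lessD)
      ultimately have k: "\<kappa> (Suc i) = Suc ?k" by simp
      have "Suc (N (Suc ?k) - Suc i) = n (Suc ?k)" using N_Suc[of ?k] i Suc(1)[of ?k] by simp
      then have "U (Suc i) ^^ 3 \<subseteq> V ?k" using pow k Suc(3)[of ?k] by simp
      then show ?thesis using U_N[of ?k] i by simp
    qed
  qed
  moreover have "\<exists>i. U i \<subseteq> W" if W: "diag_nbhd X W" for W
  proof -
    obtain e where e: "0 < e" "\<And>u v. \<lbrakk>u \<in> ?A; v \<in> ?A; \<rho> u v < e\<rbrakk> \<Longrightarrow> (u, v) \<in> W"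
      using diag_nbhd_metric_ball[OF X \<rho> W] by blast
    obtain k where k: "1 / real (Suc k) < e" using nat_approx_posE[OF e(1)] .
    have "V (Suc k) \<subseteq> B k"
      using diag_nbhd_subset_relpow[OF V(1)[of "Suc k"], of "3 ^ n (Suc k)"] Suc(3)[of k] by auto
    also have "B k \<subseteq> W" using e(2) k by (auto simp: B_def)
    finally show ?thesis using U_N by metis
  qed
  ultimately obtain d where d: "d \<in> compatible_metrics X"
    "\<And>u v i. (u, v) \<in> U i \<Longrightarrow> d u v \<le> (1 / 2) ^ i"
    using compatible_metric_of_entourages[of X U] by blast
  have "(x, y) \<in> metric_chain_rel X d f"
    unfolding metric_chain_rel_def
  proof (intro CollectI case_prodI conjI allI impI)
    show "x \<in> ?A" "y \<in> ?A" using xy by (auto simp: W_rel_def)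
  next
    fix e :: real assume "0 < e"
    then obtain k where k: "(1 / 2) ^ k < e" using real_arch_pow_inv[of e "1/2"] by auto
    let ?n = "n (Suc k)"
    obtain a b where "nbhd_chain f (V (Suc k)) x y ?n a b" using Suc(2) by blast
    then have ch: "\<forall>i\<in>{1..?n}. (a i, b i) \<in> f" "chain_gap x y ?n a b ` {..?n} \<subseteq> U (N (Suc k))"
      by (auto simp: nbhd_chain_iff_gaps U_N)
    \<comment> \<open>Each of the \<open>?n + 1\<close> gaps has length at most
      \<open>2 ^ -?n * 2 ^ -N k\<close>. Since \<open>?n + 1 \<le> 2 ^ ?n\<close> and
      \<open>k \<le> N k\<close>, the total is at most \<open>2 ^ -k\<close>.\<close>
    have "(\<Sum>i\<le>?n. d (fst (chain_gap x y ?n a b i)) (snd (chain_gap x y ?n a b i)))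
        \<le> (\<Sum>i\<le>?n. (1 / 2) ^ N (Suc k))"
      using ch(2) by (intro sum_mono d(2)) auto
    also have "\<dots> = (real (Suc ?n) / 2 ^ ?n) * (1 / 2) ^ N k"
      by (simp add: N_Suc power_add power_one_over divide_simps)
    also have "\<dots> \<le> 1 * (1 / 2) ^ k"
    proof (intro mult_mono power_decreasing N_ge)
      have "real (Suc ?n) \<le> real (2 ^ ?n)" using less_exp[of ?n] by (simp only: of_nat_le_iff Suc_leI)
      then show "real (Suc ?n) / 2 ^ ?n \<le> 1" by (simp add: divide_simps)
    qed auto
    finally have "d x (a 1) + (\<Sum>i=1..<?n. d (b i) (a (i + 1))) + d (b ?n) y < e"
      unfolding sum_chain_gap[OF Suc(1)[of k]] using k by simp
    then show "\<exists>n a b. 1 \<le> n \<and> (\<forall>i\<in>{1..n::nat}. (a i, b i) \<in> f) \<and>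
        d x (a 1) + (\<Sum>i=1..<n. d (b i) (a (i + 1))) + d (b n) y < e"
      using ch(1) Suc(1)[of k] by blast
  qed
  then show ?thesis using that d(1) by blast
qed

theorem theorem8p2:
  fixes X :: "'a topology" and f :: "('a \<times> 'a) set"
  assumes "compact_space X" and "metrizable_space X"
    and "f \<subseteq> topspace X \<times> topspace X"
  shows "closedin (prod_topology X X) (W_rel X f) \<and> trans (W_rel X f) \<and>
    W_rel X f = (\<Union>d\<in>compatible_metrics X. metric_chain_rel X d f)"
proof (intro conjI transI equalityI subsetI)
  show "closedin (prod_topology X X) (W_rel X f)" using closedin_W_rel assms .
next
  \<comment> \<open>Only the first pair is converted to metric chains, for a metric of its own; the
    second stays in \<open>W_rel\<close>, which avoids looking for a metric common to both.\<close>
  fix x y z assume "(x, y) \<in> W_rel X f" "(y, z) \<in> W_rel X f"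
  then show "(x, z) \<in> W_rel X f"
    using W_rel_metric[OF assms(1,2)] metric_chain_rel_W_rel_comp[OF assms(1) _ assms(3)] by metis
next
  fix p assume "p \<in> W_rel X f"
  then show "p \<in> (\<Union>d\<in>compatible_metrics X. metric_chain_rel X d f)"
    using W_rel_metric[OF assms(1,2)] by (cases p) blast
next
  fix p assume "p \<in> (\<Union>d\<in>compatible_metrics X. metric_chain_rel X d f)"
  then show "p \<in> W_rel X f" using metric_chain_rel_subset_W_rel[OF assms(1) _ assms(3)] by blast
qed

end
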